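(* Let $n$ and $\Delta$ be positive integers and let $T$ be a tree on $n$ vertices with maximum vertex degree $\Delta$ such that $T$ is not isomorphic to the broom $B(n,\Delta)$. Then $$ecc(B(n,\Delta)) > ecc(T).$$
   Context: For a connected graph $H$ on vertex set $V$ with $|V|=n$, the eccentricity of a vertex $v$ is $\varepsilon(v)=\max_{u\in V} d(u,v)$ ($d$ the shortest-path distance), and $ecc(H)=\frac{1}{n}\sum_{v\in V}\varepsilon(v)$ is the average eccentricity. The broom $B(n,\Delta)$ is the tree on $n$ vertices consisting of a star $S_{\Delta+1}$ (a center joined to $\Delta$ leaves) together with a path of length $n-\Delta-1$ attached to one of the pendent vertices of the star (i.e. the pendent vertex of the star is an end vertex of a path with $n-\Delta-1$ further new vertices). *)

theory Defs
  imports "Graph_Theory.Graph_Theory"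
begin

text \<open>
  A finite simple undirected graph is a symmetric digraph without loops and parallel arcs
  (locale \<^locale>\<open>graph\<close>): the edge \<open>uv\<close> is the pair of opposite arcs between \<open>u\<close> and \<open>v\<close>, so the
  degree of a vertex is its out-degree.  In this encoding traversing an edge back and forth is a
  directed cycle of length 2, which makes \<^const>\<open>tree\<close> unsuitable for undirected graphs; the
  cycles of the undirected graph are the directed cycles of length at least 3.
\<close>

definition undirected_tree :: "('a, 'b) pre_digraph \<Rightarrow> bool" where
  "undirected_tree G \<longleftrightarrow>
     graph G \<and> connected G \<and> \<not> (\<exists>p. pre_digraph.cycle G p \<and> 3 \<le> length p)"

definition max_degree :: "('a, 'b) pre_digraph \<Rightarrow> nat" where
  "max_degree G = Max (out_degree G ` verts G)"

definition graph_dist :: "('a, 'b) pre_digraph \<Rightarrow> 'a \<Rightarrow> 'a \<Rightarrow> real" where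
  "graph_dist G u v = real_of_ereal (wf_digraph.\<mu> G (\<lambda>_. 1) u v)"

definition eccentricity :: "('a, 'b) pre_digraph \<Rightarrow> 'a \<Rightarrow> real" where
  "eccentricity G v = Max ((\<lambda>u. graph_dist G u v) ` verts G)"

definition ecc :: "('a, 'b) pre_digraph \<Rightarrow> real" where
  "ecc G = (1 / real (card (verts G))) * (\<Sum>v\<in>verts G. eccentricity G v)"

text \<open>
  The broom \<open>B(n, \<Delta>)\<close> for \<open>1 \<le> \<Delta> < n\<close>: a star with centre \<open>0\<close> and leaves \<open>1, \<dots>, \<Delta>\<close>, and the
  path \<open>\<Delta>, \<Delta> + 1, \<dots>, n - 1\<close> of length \<open>n - \<Delta> - 1\<close> starting in the leaf \<open>\<Delta>\<close>.
\<close>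

definition broom_edges :: "nat \<Rightarrow> nat \<Rightarrow> (nat \<times> nat) set" where
  "broom_edges n \<Delta> = {(0, i) | i. 1 \<le> i \<and> i \<le> \<Delta>} \<union> {(i, i + 1) | i. \<Delta> \<le> i \<and> i + 1 < n}"

definition broom :: "nat \<Rightarrow> nat \<Rightarrow> (nat, nat \<times> nat) pre_digraph" where
  "broom n \<Delta> =
     \<lparr> verts = {..<n}, arcs = broom_edges n \<Delta> \<union> (broom_edges n \<Delta>)\<inverse>, tail = fst, head = snd \<rparr>"

end

theory Submission
  imports Defs
begin

text \<open>
  Let \<open>p\<close> be a longest geodesic of the tree, of length \<open>d\<close>.  In a tree a vertex has at most one
  neighbour that is not farther from a given root, so the distance to a fixed vertex has no local
  maximum in the interior of \<open>p\<close>; since it is at most \<open>d\<close> at both ends, \<open>p i\<close> has eccentricity at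
  most \<open>max i (d - i)\<close>.  The remaining \<open>n - d - 1\<close> vertices have eccentricity at most \<open>d\<close>, and the
  resulting bound for the sum is strictly increasing in \<open>d\<close>.  Counting the neighbours of a vertex
  of degree \<open>\<Delta>\<close> gives \<open>d \<le> n - \<Delta> + 1\<close>, which is the diameter of the broom, and in the broom the
  bound is attained.  If \<open>d = n - \<Delta> + 1\<close>, the vertices off \<open>p\<close> are all adjacent to one inner vertex
  \<open>p k\<close>: for \<open>k = 1\<close> or \<open>k = d - 1\<close> the tree is the broom, and otherwise these vertices have
  eccentricity less than \<open>d\<close>.
\<close>

unbundle no funcset_syntax

section \<open>Distances in connected graphs\<close>

definition (in pre_digraph) hop_dist :: "'a \<Rightarrow> 'a \<Rightarrow> nat" where
  "hop_dist u v = (LEAST k. \<exists>p. awalk u p v \<and> length p = k)"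

text \<open>Strong connectivity yields directed walks between any two vertices directly; for a
  symmetric digraph it follows from connectedness.\<close>

locale connected_graph = graph +
  assumes strongly_connected: "strongly_connected G"
begin

lemma adj_sym: "u \<rightarrow> v \<Longrightarrow> v \<rightarrow> u"
  using arcs_ends_symmetric[OF sym_arcs] .

lemma adj_neq: "u \<rightarrow> v \<Longrightarrow> u \<noteq> v"
  using adj_not_same by blast

lemma hop_dist_awalk:
  assumes "u \<in> verts G" "v \<in> verts G"
  obtains p where "awalk u p v" "length p = hop_dist u v"
proof -
  have "u \<rightarrow>\<^sup>* v"
    using assms strongly_connected by blast
  then have "\<exists>k p. awalk u p v \<and> length p = k"
    by (simp add: reachable_awalk)
  from LeastI_ex[OF this] show ?thesis
    using that unfolding hop_dist_def by blast
qed

lemma hop_dist_le: "awalk u p v \<Longrightarrow> hop_dist u v \<le> length p"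
  unfolding hop_dist_def by (rule Least_le) blast

text \<open>With unit weights the cost of a walk is its length, and the infimum defining
  \<open>\<mu>\<close> is attained by a shortest walk. From here on distances are natural
  numbers.\<close>

lemma graph_dist_conv_hop_dist:
  assumes "u \<in> verts G" "v \<in> verts G"
  shows "graph_dist G u v = real (hop_dist u v)"
proof -
  have cost: "awalk_cost (\<lambda>_. 1) p = real (length p)" for p :: "'b list"
    by (induction p) auto
  obtain p where p: "awalk u p v" "length p = hop_dist u v"
    using hop_dist_awalk assms by blast
  have "\<mu> (\<lambda>_. 1) u v = ereal (real (hop_dist u v))"
    unfolding \<mu>_def cost
  proof (rule INF_eqI)
    fix y assume "\<And>i. i \<in> {p. awalk u p v} \<Longrightarrow> y \<le> ereal (real (length i))"
    then show "y \<le> ereal (real (hop_dist u v))"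
      using p by force
  qed (auto intro: hop_dist_le)
  then show ?thesis
    by (simp add: graph_dist_def)
qed

lemma hop_dist_triangle:
  assumes "u \<in> verts G" "v \<in> verts G" "w \<in> verts G"
  shows "hop_dist u w \<le> hop_dist u v + hop_dist v w"
proof -
  obtain p q where p: "awalk u p v" "length p = hop_dist u v"
    and q: "awalk v q w" "length q = hop_dist v w"
    using hop_dist_awalk assms by metis
  show ?thesis
    using hop_dist_le[OF awalk_appendI[OF p(1) q(1)]] p q by simp
qed

lemma hop_dist_self: "u \<in> verts G \<Longrightarrow> hop_dist u u = 0"
  using hop_dist_le[of u "[]" u] by (simp add: awalk_Nil_iff)

lemma hop_dist_eq_0D: "u \<in> verts G \<Longrightarrow> v \<in> verts G \<Longrightarrow> hop_dist u v = 0 \<Longrightarrow> u = v"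
  by (rule hop_dist_awalk[of u v]) (auto simp: awalk_Nil_iff)

lemma hop_dist_adj:
  assumes "u \<rightarrow> v"
  shows "hop_dist u v = 1"
proof -
  obtain e where e: "e \<in> arcs G" "tail G e = u" "head G e = v"
    using assms by blast
  then have "hop_dist u v \<le> 1"
    using hop_dist_le[OF arc_implies_awalk[OF e(1)]] by simp
  moreover have "hop_dist u v \<noteq> 0"
    using hop_dist_eq_0D adj_in_verts[OF assms] adj_neq[OF assms] by blast
  ultimately show ?thesis by simp
qed

text \<open>The vertex set is recorded because \<open>closer_neighbour_unique\<close> reverses a
  walk that avoids a given vertex.\<close>

lemma awalk_rev:
  assumes "awalk u p v"
  shows "\<exists>q. awalk v q u \<and> length q = length p \<and> set (awalk_verts v q) = set (awalk_verts u p)"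
  using assms
proof (induction p arbitrary: u)
  case Nil
  then show ?case by (auto simp: awalk_Nil_iff)
next
  case (Cons e p)
  then obtain q where q: "awalk v q (head G e)" "length q = length p"
      "set (awalk_verts v q) = set (awalk_verts (head G e) p)"
    by (auto simp: awalk_Cons_iff)
  have e: "e \<in> arcs G" "tail G e = u"
    using Cons.prems by (auto simp: awalk_Cons_iff)
  then obtain e' where e': "e' \<in> arcs G" "tail G e' = head G e" "head G e' = u"
    using adj_sym[OF in_arcs_imp_in_arcs_ends[OF e(1)]] by blast
  have e'_walk: "awalk (head G e) [e'] u"
    using arc_implies_awalk[OF e'(1)] e' by simp
  have "set (awalk_verts v (q @ [e'])) = set (awalk_verts u (e # p))"
    using set_awalk_verts_append[OF q(1) e'_walk] q(1,3) e e'
      hd_in_awalk_verts(1)[of "head G e" p v] Cons.prems by (auto simp: awalk_Cons_iff)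
  moreover have "length (q @ [e']) = length (e # p)"
    using q(2) by simp
  ultimately show ?case
    using awalk_appendI[OF q(1) e'_walk] by blast
qed

lemma hop_dist_commute:
  assumes "u \<in> verts G" "v \<in> verts G"
  shows "hop_dist u v = hop_dist v u"
proof -
  have "hop_dist x y \<le> hop_dist y x" if "x \<in> verts G" "y \<in> verts G" for x y
  proof -
    obtain p where p: "awalk y p x" "length p = hop_dist y x"
      using hop_dist_awalk \<open>y \<in> verts G\<close> \<open>x \<in> verts G\<close> by blast
    then obtain q where "awalk x q y" "length q = length p"
      using awalk_rev by blast
    then show ?thesis
      using hop_dist_le[of x q y] p(2) by simp
  qed
  then show ?thesis
    using assms by (simp add: le_antisym)
qed

lemma hop_dist_pred:
  assumes "r \<in> verts G" "v \<in> verts G" "hop_dist r v = Suc k"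
  obtains x where "x \<rightarrow> v" "hop_dist r x = k"
proof -
  obtain p where p: "awalk r p v" "length p = hop_dist r v"
    using hop_dist_awalk assms by blast
  then obtain q e where qe: "p = q @ [e]" "length q = k"
    using assms(3) by (metis length_Suc_conv_rev)
  then have q: "awalk r q (tail G e)" and e: "e \<in> arcs G" "head G e = v"
    using p(1) by (auto simp: awalk_simps)
  have adj: "tail G e \<rightarrow> v"
    using e in_arcs_imp_in_arcs_ends by blast
  have "hop_dist r (tail G e) \<le> k"
    using hop_dist_le[OF q] qe by simp
  moreover have "hop_dist r v \<le> hop_dist r (tail G e) + 1"
    using hop_dist_triangle[of r "tail G e" v] assms e adj hop_dist_adj[OF adj] by simp
  ultimately show ?thesis
    using that[OF adj] assms(3) by simp
qed

text \<open>Gives lower bounds on distances in the broom from an explicit vertex labelling, without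
  computing shortest walks there.\<close>

lemma hop_dist_lipschitz:
  fixes f :: "'a \<Rightarrow> nat"
  assumes "\<And>x y. x \<rightarrow> y \<Longrightarrow> f y \<le> f x + 1" and uv: "u \<in> verts G" "v \<in> verts G"
  shows "f v \<le> f u + hop_dist u v"
proof -
  have walk: "f v \<le> f u + length p" if "awalk u p v" for p u
    using that
  proof (induction p arbitrary: u)
    case (Cons e p)
    then have "f v \<le> f (head G e) + length p" "f (head G e) \<le> f u + 1"
      using assms(1) in_arcs_imp_in_arcs_ends by (auto simp: awalk_Cons_iff)
    then show ?case by simp
  qed (simp add: awalk_Nil_iff)
  show ?thesis
    using hop_dist_awalk[OF uv] walk by metis
qed

lemma eccentricity_le:
  assumes "v \<in> verts G" "\<And>u. u \<in> verts G \<Longrightarrow> hop_dist u v \<le> k"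
  shows "eccentricity G v \<le> real k"
  unfolding eccentricity_def using assms
  by (subst Max_le_iff) (auto simp: graph_dist_conv_hop_dist)

lemma hop_dist_le_eccentricity:
  assumes "v \<in> verts G" "u \<in> verts G"
  shows "real (hop_dist u v) \<le> eccentricity G v"
  unfolding eccentricity_def using assms
  by (intro Max_ge) (auto simp: graph_dist_conv_hop_dist[symmetric])

lemma card_neighbours: "card {v. u \<rightarrow> v} = out_degree G u"
proof -
  have "{v. u \<rightarrow> v} = head G ` out_arcs G u"
    by (auto simp: arcs_ends_conv out_arcs_def)
  moreover have "inj_on (head G) (out_arcs G u)"
    by (auto simp: inj_on_def out_arcs_def arc_to_ends_def intro: no_multi_arcs)
  ultimately show ?thesis
    by (simp add: out_degree_def card_image)
qed

lemma finite_neighbours: "finite {v. u \<rightarrow> v}"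
  by (rule finite_subset[OF _ finite_verts]) (auto dest: adj_in_verts)

end

section \<open>Distances in trees\<close>

locale tree_graph = connected_graph +
  assumes acyclic: "cycle p \<Longrightarrow> length p < 3"
begin

text \<open>The one place where acyclicity enters: if \<open>x\<close> and \<open>y\<close> were
  distinct, shortest walks from \<open>r\<close> to them would avoid \<open>v\<close>, so they would
  yield a path from \<open>x\<close> to \<open>y\<close> avoiding \<open>v\<close>, which the two
  arcs at \<open>v\<close> close to a cycle.\<close>

lemma closer_neighbour_unique:
  assumes vx: "v \<rightarrow> x" and vy: "v \<rightarrow> y" and r: "r \<in> verts G"
    and rx: "hop_dist r x \<le> hop_dist r v" and ry: "hop_dist r y \<le> hop_dist r v"
  shows "x = y"
proof (rule ccontr)
  assume "x \<noteq> y"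
  have V: "v \<in> verts G" "x \<in> verts G" "y \<in> verts G"
    using vx vy adj_in_verts by blast+
  have walk_avoiding: "\<exists>q. awalk r q z \<and> v \<notin> set (awalk_verts r q)"
    if vz: "v \<rightarrow> z" and rz: "hop_dist r z \<le> hop_dist r v" for z
  proof -
    obtain q where q: "awalk r q z" "length q = hop_dist r z"
      using hop_dist_awalk r adj_in_verts[OF vz] by blast
    \<comment> \<open>Since \<open>v\<close> differs from \<open>z\<close>, a shortest walk to
      \<open>z\<close> through \<open>v\<close> would reach \<open>v\<close> in fewer than
      \<open>hop_dist r z\<close> steps, hence in fewer than \<open>hop_dist r v\<close>.\<close>
    have "v \<notin> set (awalk_verts r q)"
    proof
      assume "v \<in> set (awalk_verts r q)"
      then obtain q1 q2 where q12: "q = q1 @ q2" "awalk r q1 v" "awalk v q2 z"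
        using awalk_decomp[OF q(1)] by blast
      then have "q2 \<noteq> []"
        using adj_neq[OF vz] by (auto simp: awalk_Nil_iff)
      then show False
        using hop_dist_le[OF q12(2)] q12(1) q(2) rz by (cases q2) auto
    qed
    with q show ?thesis by blast
  qed
  obtain q1 q2 where q1: "awalk r q1 x" "v \<notin> set (awalk_verts r q1)"
    and q2: "awalk r q2 y" "v \<notin> set (awalk_verts r q2)"
    using walk_avoiding[OF vx rx] walk_avoiding[OF vy ry] by blast
  obtain q1' where q1': "awalk x q1' r" "v \<notin> set (awalk_verts x q1')"
    using awalk_rev[OF q1(1)] q1(2) by auto
  have q: "awalk x (q1' @ q2) y" "v \<notin> set (awalk_verts x (q1' @ q2))"
    using awalk_appendI[OF q1'(1) q2(1)] set_awalk_verts_append[OF q1'(1) q2(1)] q1' q2 by auto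
  define a where "a = awalk_to_apath (q1' @ q2)"
  have a: "awalk x a y" "distinct (awalk_verts x a)"
    using apath_awalk_to_apath[OF q(1)] by (auto simp: apath_def a_def)
  have va: "v \<notin> set (awalk_verts x a)"
    using awalk_to_apath_subset[OF q(1)] q(2)
    unfolding set_awalk_verts[OF q(1)] set_awalk_verts[OF a(1)] by (auto simp: a_def)
  \<comment> \<open>This makes the cycle \<open>e # a @ [e']\<close> have length at least 3.\<close>
  have "a \<noteq> []"
    using a(1) \<open>x \<noteq> y\<close> by (auto simp: awalk_Nil_iff)
  obtain e where e: "e \<in> arcs G" "tail G e = v" "head G e = x"
    using vx by blast
  obtain e' where e': "e' \<in> arcs G" "tail G e' = y" "head G e' = v"
    using adj_sym[OF vy] by blast
  have ae': "awalk x (a @ [e']) v"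
    using a(1) e' V by (auto simp: awalk_simps)
  have "awalk_verts x (a @ [e']) = awalk_verts x a @ [v]"
    using awalk_verts_append[OF ae'] e' by simp
  then have "cycle (e # a @ [e'])"
    unfolding cycle_def using ae' e va a(2) by (intro exI[of _ v]) (auto simp: awalk_Cons_iff)
  then show False
    using acyclic[of "e # a @ [e']"] \<open>a \<noteq> []\<close> by (cases a) auto
qed

text \<open>Trees are bipartite: if \<open>x\<close> and \<open>y\<close> were equally far from
  \<open>r\<close>, then \<open>y\<close> and the predecessor of \<open>x\<close> on a shortest walk
  would be two neighbours of \<open>x\<close> that are not farther from \<open>r\<close>.\<close>

lemma hop_dist_adj_cases:
  assumes xy: "x \<rightarrow> y" and r: "r \<in> verts G"
  shows "hop_dist r y = Suc (hop_dist r x) \<or> hop_dist r x = Suc (hop_dist r y)"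
proof -
  have V: "x \<in> verts G" "y \<in> verts G"
    using adj_in_verts[OF xy] by auto
  have "hop_dist r y \<le> Suc (hop_dist r x)" "hop_dist r x \<le> Suc (hop_dist r y)"
    using hop_dist_triangle[OF r V] hop_dist_triangle[OF r V(2) V(1)]
      hop_dist_adj[OF xy] hop_dist_adj[OF adj_sym[OF xy]] by auto
  moreover have "hop_dist r x \<noteq> hop_dist r y"
  proof
    assume eq: "hop_dist r x = hop_dist r y"
    show False
    proof (cases "hop_dist r x")
      case 0
      then show False
        using eq hop_dist_eq_0D[OF r] V adj_neq[OF xy] by metis
    next
      case (Suc k)
      obtain z where z: "z \<rightarrow> x" "hop_dist r z = k"
        using hop_dist_pred[OF r V(1) Suc] .
      then have "z = y"
        using closer_neighbour_unique[OF adj_sym[OF z(1)] xy r] Suc eq by simp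
      then show False
        using z(2) Suc eq by simp
    qed
  qed
  ultimately show ?thesis by linarith
qed

section \<open>Geodesics in trees\<close>

text \<open>Only the values of \<open>p\<close> up to \<open>d\<close> matter. Requiring the right
  distance between the ends is enough, as \<open>geodesic_hop_dist\<close> shows.\<close>

definition geodesic :: "(nat \<Rightarrow> 'a) \<Rightarrow> nat \<Rightarrow> bool" where
  "geodesic p d \<longleftrightarrow> p 0 \<in> verts G \<and> (\<forall>i<d. p i \<rightarrow> p (Suc i)) \<and> hop_dist (p 0) (p d) = d"

lemma geodesic_exists:
  assumes "u \<in> verts G" "v \<in> verts G"
  obtains p where "geodesic p (hop_dist u v)" "p 0 = u" "p (hop_dist u v) = v"
proof -
  have "\<exists>p. geodesic p d \<and> p 0 = u \<and> p d = v" if "v \<in> verts G" "hop_dist u v = d" for v d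
    using that
  proof (induction d arbitrary: v)
    case 0
    then have "u = v"
      using hop_dist_eq_0D assms(1) by blast
    with 0 show ?case
      by (intro exI[of _ "\<lambda>_. u"]) (simp add: geodesic_def)
  next
    case (Suc d)
    obtain x where x: "x \<rightarrow> v" "hop_dist u x = d"
      using hop_dist_pred[OF assms(1) Suc.prems] .
    then obtain p where "geodesic p d" "p 0 = u" "p d = x"
      using Suc.IH adj_in_verts by blast
    with x Suc.prems show ?case
      by (intro exI[of _ "p(Suc d := v)"]) (auto simp: geodesic_def less_Suc_eq)
  qed
  then show ?thesis
    using that assms(2) by blast
qed

lemma geodesic_adj: "geodesic p d \<Longrightarrow> i < d \<Longrightarrow> p i \<rightarrow> p (Suc i)"
  by (simp add: geodesic_def)

lemma geodesic_in_verts: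
  assumes "geodesic p d" "i \<le> d"
  shows "p i \<in> verts G"
proof (cases i)
  case 0
  then show ?thesis using assms by (simp add: geodesic_def)
next
  case (Suc j)
  then show ?thesis
    using adj_in_verts[OF geodesic_adj[OF assms(1), of j]] assms(2) by simp
qed

text \<open>Each piece of the path is at least as long as the distance it spans, and by the triangle
  inequality the three distances add up to at least \<open>d\<close>, so none of them can fall
  short.\<close>

lemma geodesic_hop_dist:
  assumes "geodesic p d" "i \<le> j" "j \<le> d"
  shows "hop_dist (p i) (p j) = j - i"
proof -
  note V = geodesic_in_verts[OF assms(1)]
  have le: "hop_dist (p i) (p j) \<le> j - i" if "i \<le> j" "j \<le> d" for i j
    using that
  proof (induction j rule: dec_induct)
    case base
    then show ?case using V hop_dist_self by simp
  next
    case (step k)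
    have "hop_dist (p i) (p (Suc k)) \<le> hop_dist (p i) (p k) + hop_dist (p k) (p (Suc k))"
      using V step by (intro hop_dist_triangle) auto
    also have "hop_dist (p k) (p (Suc k)) = 1"
      using geodesic_adj[OF assms(1), of k] step hop_dist_adj by simp
    finally show ?case using step by simp
  qed
  have "hop_dist (p 0) (p d) = d"
    using assms(1) by (simp add: geodesic_def)
  moreover have "hop_dist (p 0) (p d) \<le> hop_dist (p 0) (p i) + hop_dist (p i) (p d)"
    "hop_dist (p i) (p d) \<le> hop_dist (p i) (p j) + hop_dist (p j) (p d)"
    using V assms by (auto intro!: hop_dist_triangle)
  moreover have "hop_dist (p 0) (p i) \<le> i" "hop_dist (p j) (p d) \<le> d - j"
    using le[of 0 i] le[of j d] assms by auto
  ultimately show ?thesis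
    using le[of i j] assms by linarith
qed

lemma geodesic_inj:
  assumes "geodesic p d"
  shows "inj_on p {..d}"
proof (rule linorder_inj_onI)
  fix i j assume "i < j" "i \<in> {..d}" "j \<in> {..d}"
  then show "p i \<noteq> p j"
    using geodesic_hop_dist[OF assms, of i j] geodesic_in_verts[OF assms, of i] hop_dist_self by auto
qed auto

lemma geodesic_rev:
  assumes "geodesic p d"
  shows "geodesic (\<lambda>i. p (d - i)) d"
proof -
  have "p (d - i) \<rightarrow> p (d - Suc i)" if "i < d" for i
    using adj_sym[OF geodesic_adj[OF assms, of "d - Suc i"]] that by (simp add: Suc_diff_Suc)
  moreover have "hop_dist (p d) (p 0) = d"
    using hop_dist_commute geodesic_in_verts[OF assms] geodesic_hop_dist[OF assms, of 0 d] by simp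
  ultimately show ?thesis
    using geodesic_in_verts[OF assms] by (simp add: geodesic_def)
qed

lemma geodesic_adj_iff:
  assumes "geodesic p d" "i \<le> d" "j \<le> d"
  shows "p i \<rightarrow> p j \<longleftrightarrow> j = Suc i \<or> i = Suc j"
proof
  have aux: "j = Suc i" if "p i \<rightarrow> p j" "i \<le> j" "j \<le> d" for i j
    using geodesic_hop_dist[OF assms(1) that(2,3)] hop_dist_adj[OF that(1)] by simp
  assume ij: "p i \<rightarrow> p j"
  show "j = Suc i \<or> i = Suc j"
    using aux[OF ij] aux[OF adj_sym[OF ij]] assms(2,3) by linarith
next
  assume "j = Suc i \<or> i = Suc j"
  then show "p i \<rightarrow> p j"
    using geodesic_adj[OF assms(1)] adj_sym assms(2,3) by auto
qed

text \<open>A vertex of the geodesic at which the distance to \<open>u\<close> had a local maximum would have two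
  neighbours closer to \<open>u\<close>.\<close>

lemma hop_dist_geodesic_increasing:
  assumes p: "geodesic p d" and u: "u \<in> verts G"
    and up: "hop_dist u (p (Suc i)) = Suc (hop_dist u (p i))"
    and ij: "i < j" "j \<le> d"
  shows "hop_dist u (p j) = hop_dist u (p i) + (j - i)"
proof -
  have "hop_dist u (p (i + k)) = hop_dist u (p i) + k \<and>
      hop_dist u (p (Suc (i + k))) = hop_dist u (p i) + Suc k" if "Suc (i + k) \<le> d" for k
    using that
  proof (induction k)
    case 0
    then show ?case using up by simp
  next
    case (Suc k)
    let ?v = "p (Suc (i + k))" and ?x = "p (i + k)" and ?y = "p (Suc (Suc (i + k)))"
    have adj: "?v \<rightarrow> ?x" "?v \<rightarrow> ?y"
      using Suc.prems p by (auto simp: geodesic_adj_iff)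
    have vx: "hop_dist u ?v = hop_dist u (p i) + Suc k" "hop_dist u ?x = hop_dist u (p i) + k"
      using Suc by simp_all
    have "?x \<noteq> ?y"
      using inj_onD[OF geodesic_inj[OF p], of "i + k" "Suc (Suc (i + k))"] Suc.prems by auto
    then have "\<not> hop_dist u ?y \<le> hop_dist u ?v"
      using closer_neighbour_unique[OF adj u] vx by auto
    then show ?case
      using hop_dist_adj_cases[OF adj(2) u] vx by simp
  qed
  from this[of "j - i - 1"] show ?thesis
    using ij by simp
qed

text \<open>At an inner index the distance to \<open>u\<close> either grows towards
  \<open>p (Suc i)\<close>, and then all the way to \<open>p d\<close>, or it grows from
  \<open>p (Suc i)\<close> back to \<open>p 0\<close>. As it is at most \<open>d\<close> at both
  ends, it is at most \<open>i\<close> in the first case and at most \<open>d - i\<close> in the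
  second.\<close>

lemma hop_dist_geodesic_le:
  assumes p: "geodesic p d" and u: "u \<in> verts G"
    and diam: "hop_dist u (p 0) \<le> d" "hop_dist u (p d) \<le> d" and i: "i \<le> d"
  shows "hop_dist u (p i) \<le> max i (d - i)"
proof (cases "i = 0 \<or> i = d")
  case True
  then show ?thesis using diam by auto
next
  case False
  then have "p i \<rightarrow> p (Suc i)"
    using geodesic_adj[OF p] i by simp
  then consider "hop_dist u (p (Suc i)) = Suc (hop_dist u (p i))"
    | "hop_dist u (p i) = Suc (hop_dist u (p (Suc i)))"
    using hop_dist_adj_cases u by blast
  then show ?thesis
  proof cases
    case 1
    then show ?thesis
      using hop_dist_geodesic_increasing[OF p u 1, of d] False i diam by simp
  next
    case 2
    \<comment> \<open>On the reversed geodesic \<open>p (Suc i)\<close> has index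
      \<open>d - Suc i\<close>, and index \<open>d\<close> is \<open>p 0\<close>.\<close>
    then show ?thesis
      using hop_dist_geodesic_increasing[OF geodesic_rev[OF p] u, of "d - Suc i" d] False i diam
      by (simp add: Suc_diff_Suc)
  qed
qed

text \<open>From the first neighbour \<open>p i\<close> of \<open>u\<close> the distance to
  \<open>u\<close> must rise from 1 to 2, because \<open>u\<close> itself is off the path; it then
  keeps rising and cannot be 1 again at \<open>p j\<close>.\<close>

lemma off_geodesic_neighbour_unique:
  assumes p: "geodesic p d" and u: "u \<notin> p ` {..d}"
    and i: "i \<le> d" "u \<rightarrow> p i" and j: "j \<le> d" "u \<rightarrow> p j"
  shows "i = j"
proof -
  have aux: "\<not> i < j" if "i \<le> d" "u \<rightarrow> p i" "j \<le> d" "u \<rightarrow> p j" for i j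
  proof
    assume "i < j"
    have uV: "u \<in> verts G"
      using adj_in_verts[OF that(2)] by simp
    have "u \<noteq> p (Suc i)"
      using u \<open>i < j\<close> \<open>j \<le> d\<close> by auto
    then have "hop_dist u (p (Suc i)) \<noteq> 0"
      using hop_dist_eq_0D[OF uV] geodesic_in_verts[OF p, of "Suc i"] \<open>i < j\<close> \<open>j \<le> d\<close> by auto
    then have "hop_dist u (p (Suc i)) = Suc (hop_dist u (p i))"
      using hop_dist_adj_cases[OF geodesic_adj[OF p, of i] uV] hop_dist_adj[OF that(2)]
        \<open>i < j\<close> \<open>j \<le> d\<close> by auto
    from hop_dist_geodesic_increasing[OF p uV this \<open>i < j\<close> \<open>j \<le> d\<close>] show False
      using hop_dist_adj[OF that(2)] hop_dist_adj[OF that(4)] \<open>i < j\<close> by simp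
  qed
  show ?thesis
    using aux[OF i j] aux[OF j i] by simp
qed

end

section \<open>Isomorphism from a bijection of the vertices\<close>

text \<open>Without parallel arcs an arc is determined by its ends, so the arc map comes for free.
  The bijection starts in \<open>H\<close> because maps out of the numbered vertices of the broom
  are easy to define.\<close>

lemma digraph_isoI:
  assumes G: "nomulti_digraph G" and H: "nomulti_digraph H"
    and f: "bij_betw f (verts H) (verts G)"
    and adj: "\<And>x y. x \<in> verts H \<Longrightarrow> y \<in> verts H \<Longrightarrow> x \<rightarrow>\<^bsub>H\<^esub> y \<longleftrightarrow> f x \<rightarrow>\<^bsub>G\<^esub> f y"
  shows "digraph_iso G H"
proof -
  interpret G: nomulti_digraph G by fact
  interpret H: nomulti_digraph H by fact
  define g where "g = the_inv_into (verts H) f"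
  have g: "bij_betw g (verts G) (verts H)"
    unfolding g_def by (rule bij_betw_the_inv_into[OF f])
  have fg: "f (g x) = x" if "x \<in> verts G" for x
    using f_the_inv_into_f_bij_betw[OF f, of x] that by (simp add: g_def)
  have gf: "g (f x) = x" if "x \<in> verts H" for x
    using the_inv_into_f_f[OF bij_betw_imp_inj_on[OF f] that] by (simp add: g_def)
  have gV: "g x \<in> verts H" if "x \<in> verts G" for x
    using g that by (auto simp: bij_betw_def)
  have fV: "f x \<in> verts G" if "x \<in> verts H" for x
    using f that by (auto simp: bij_betw_def)
  \<comment> \<open>The unique arc of \<open>H\<close> between the images of the ends of
    \<open>e\<close>.\<close>
  define h where "h e = the_inv_into (arcs H) (arc_to_ends H) (g (tail G e), g (head G e))" for e
  have ends: "(g (tail G e), g (head G e)) \<in> arcs_ends H" if "e \<in> arcs G" for e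
    using adj[of "g (tail G e)" "g (head G e)"] that by (simp add: gV fg G.in_arcs_imp_in_arcs_ends)
  have h: "h e \<in> arcs H" "tail H (h e) = g (tail G e)" "head H (h e) = g (head G e)"
    if "e \<in> arcs G" for e
    using the_inv_into_into[OF H.inj_on_arc_to_ends ends[OF that, unfolded arcs_ends_def] order_refl]
      f_the_inv_into_f[OF H.inj_on_arc_to_ends ends[OF that, unfolded arcs_ends_def]]
    by (auto simp: h_def arc_to_ends_def)
  have "inj_on h (arcs G)"
  proof (rule inj_onI)
    fix a b assume ab: "a \<in> arcs G" "b \<in> arcs G" "h a = h b"
    then have "g (tail G a) = g (tail G b)" "g (head G a) = g (head G b)"
      using h by metis+
    then have "arc_to_ends G a = arc_to_ends G b"
      using fg ab by (metis G.head_in_verts G.tail_in_verts arc_to_ends_def)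
    then show "a = b"
      using ab G.no_multi_arcs by blast
  qed
  moreover have "h ` arcs G = arcs H"
  proof (intro subset_antisym subsetI)
    fix e assume e: "e \<in> arcs H"
    then have "f (tail H e) \<rightarrow>\<^bsub>G\<^esub> f (head H e)"
      using adj H.in_arcs_imp_in_arcs_ends by simp
    then obtain e' where e': "e' \<in> arcs G" "tail G e' = f (tail H e)" "head G e' = f (head H e)"
      by blast
    then have "arc_to_ends H (h e') = arc_to_ends H e"
      using h e gf by (simp add: arc_to_ends_def)
    then show "e \<in> h ` arcs G"
      using e e' h(1) H.no_multi_arcs by blast
  qed (use h in auto)
  ultimately have "pre_digraph.digraph_isomorphism G
      \<lparr>iso_verts = g, iso_arcs = h, iso_head = head H, iso_tail = tail H\<rparr>"
    using g h G.wf_digraph_axioms by (auto simp: pre_digraph.digraph_isomorphism_def bij_betw_def)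
  moreover have "H = app_iso \<lparr>iso_verts = g, iso_arcs = h, iso_head = head H, iso_tail = tail H\<rparr> G"
    using g \<open>h ` arcs G = arcs H\<close> by (simp add: app_iso_def bij_betw_def)
  ultimately show ?thesis
    unfolding digraph_iso_def by blast
qed

section \<open>The bound on the eccentricity sum as a function of the diameter\<close>

text \<open>This is the sum of the eccentricities in a path of length \<open>d\<close>.\<close>

definition path_ecc_sum :: "nat \<Rightarrow> nat" where
  "path_ecc_sum d = (\<Sum>i\<le>d. max i (d - i))"

lemma path_ecc_sum_Suc: "path_ecc_sum d + Suc d \<le> path_ecc_sum (Suc d)"
proof -
  have "path_ecc_sum (Suc d) = Suc d + (\<Sum>i\<le>d. max (Suc i) (d - i))"
    unfolding path_ecc_sum_def by (subst sum.atMost_Suc_shift) simp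
  moreover have "path_ecc_sum d \<le> (\<Sum>i\<le>d. max (Suc i) (d - i))"
    unfolding path_ecc_sum_def by (rule sum_mono) auto
  ultimately show ?thesis by simp
qed

text \<open>Raising the diameter from \<open>k\<close> to \<open>Suc k\<close> adds at least
  \<open>Suc k\<close> to the path part, while the off-path part loses one vertex of weight
  \<open>k\<close> and the weights of the others grow.\<close>

lemma path_ecc_sum_less:
  assumes "d < D" "D < n"
  shows "path_ecc_sum d + (n - Suc d) * d < path_ecc_sum D + (n - Suc D) * D"
proof -
  have step: "path_ecc_sum k + (n - Suc k) * k < path_ecc_sum (Suc k) + (n - Suc (Suc k)) * Suc k"
    if "Suc k < n" for k
  proof -
    obtain m where m: "n = Suc (Suc k) + m"
      using \<open>Suc k < n\<close> by (auto simp: less_iff_Suc_add)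
    show ?thesis
      using path_ecc_sum_Suc[of k] unfolding m by simp
  qed
  show ?thesis
    using assms
  proof (induction D)
    case (Suc D)
    then show ?case
      using step[of D] by (cases "d = D") auto
  qed simp
qed

section \<open>The broom\<close>

lemma arcs_ends_broom:
  "i \<rightarrow>\<^bsub>broom n \<Delta>\<^esub> j \<longleftrightarrow> (i, j) \<in> broom_edges n \<Delta> \<or> (j, i) \<in> broom_edges n \<Delta>"
  by (auto simp: arcs_ends_conv broom_def)

lemma verts_broom: "verts (broom n \<Delta>) = {..<n}"
  by (simp add: broom_def)

lemma connected_graph_broom:
  assumes "1 \<le> \<Delta>" "\<Delta> < n"
  shows "connected_graph (broom n \<Delta>)"
proof -
  interpret wf_digraph "broom n \<Delta>"
    using assms by unfold_locales (auto simp: broom_def broom_edges_def)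
  have fin: "finite (arcs (broom n \<Delta>))"
  proof (rule finite_subset)
    show "arcs (broom n \<Delta>) \<subseteq> {..<n} \<times> {..<n}"
      using tail_in_verts head_in_verts by (force simp: broom_def)
  qed simp
  interpret graph "broom n \<Delta>"
  proof unfold_locales
    show "finite (arcs (broom n \<Delta>))" by (fact fin)
    show "symmetric (broom n \<Delta>)"
      by (auto simp: symmetric_def sym_def arcs_ends_broom)
  qed (use assms in \<open>auto simp: broom_def broom_edges_def arc_to_ends_def\<close>)
  have to0: "i \<rightarrow>\<^sup>*\<^bsub>broom n \<Delta>\<^esub> 0" if "i < n" for i
    using that
  proof (induction i)
    case (Suc i)
    show ?case
    proof (cases "Suc i \<le> \<Delta>")
      case True
      then show ?thesis
        by (intro reachable_adjI) (auto simp: arcs_ends_broom broom_edges_def)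
    next
      case False
      then have "Suc i \<rightarrow>\<^bsub>broom n \<Delta>\<^esub> i"
        using Suc.prems by (auto simp: arcs_ends_broom broom_edges_def)
      then show ?thesis
        using Suc adj_reachable_trans by simp
    qed
  qed (simp add: verts_broom)
  have "strongly_connected (broom n \<Delta>)"
  proof (rule strongly_connectedI)
    show "verts (broom n \<Delta>) \<noteq> {}"
      using assms by (auto simp: verts_broom)
    show "i \<rightarrow>\<^sup>*\<^bsub>broom n \<Delta>\<^esub> j" if "i \<in> verts (broom n \<Delta>)" "j \<in> verts (broom n \<Delta>)" for i j
      using reachable_trans[OF to0[of i] symmetric_reachable[OF sym_arcs to0[of j]]] that
      by (simp add: verts_broom)
  qed
  then show ?thesis
    by unfold_locales
qed

text \<open>The path from leaf 1 through the centre and leaf \<open>\<Delta>\<close> to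
  \<open>n - 1\<close> has length \<open>D\<close>. The bound compares every vertex with the two
  ends of this path.\<close>

lemma sum_eccentricity_broom_ge:
  assumes "2 \<le> \<Delta>" "\<Delta> < n" and D: "D = Suc n - \<Delta>"
  shows "real (path_ecc_sum D + (n - Suc D) * D) \<le> (\<Sum>v<n. eccentricity (broom n \<Delta>) v)"
proof -
  interpret connected_graph "broom n \<Delta>"
    using connected_graph_broom assms by simp
  \<comment> \<open>The position on that path, counted from leaf 1; the leaves
    \<open>2, ..., \<Delta> - 1\<close> off the path share the position 0 of leaf 1.\<close>
  define f where "f i = (if i = 0 then 1 else if i < \<Delta> then 0 else i + 2 - \<Delta>)" for i
  have lip: "f j \<le> f i + 1" if "i \<rightarrow>\<^bsub>broom n \<Delta>\<^esub> j" for i j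
    using that assms by (auto simp: arcs_ends_broom broom_edges_def f_def)
  have ge: "real (max (f v) (D - f v)) \<le> eccentricity (broom n \<Delta>) v" if "v < n" for v
  proof -
    have "f v \<le> f 1 + hop_dist 1 v" "f (n - 1) \<le> f v + hop_dist v (n - 1)"
      using assms that by (auto intro!: hop_dist_lipschitz lip simp: verts_broom)
    moreover have "f 1 = 0" "f (n - 1) = D"
      using assms by (auto simp: f_def)
    moreover have "real (hop_dist 1 v) \<le> eccentricity (broom n \<Delta>) v"
      "real (hop_dist (n - 1) v) \<le> eccentricity (broom n \<Delta>) v"
      using assms that by (auto intro!: hop_dist_le_eccentricity simp: verts_broom)
    moreover have "hop_dist v (n - 1) = hop_dist (n - 1) v"
      using assms that by (intro hop_dist_commute) (auto simp: verts_broom)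
    ultimately show ?thesis by simp
  qed
  define b where "b v = max (f v) (D - f v)" for v
  \<comment> \<open>The leaves off the path contribute \<open>D\<close> each, and there are
    \<open>\<Delta> - 2 = n - Suc D\<close> of them; \<open>f\<close> maps the remaining vertices
    bijectively to the positions.\<close>
  have split: "{..<n} = {2..<\<Delta>} \<union> ({0, 1} \<union> {\<Delta>..<n})"
    using assms by auto
  have "(\<Sum>v<n. b v) = (\<Sum>v\<in>{2..<\<Delta>}. b v) + (\<Sum>v\<in>{0, 1} \<union> {\<Delta>..<n}. b v)"
    unfolding split using assms by (intro sum.union_disjoint) auto
  moreover have "(\<Sum>v\<in>{2..<\<Delta>}. b v) = (n - Suc D) * D"
    using assms by (simp add: b_def f_def)
  moreover have "(\<Sum>v\<in>{0, 1} \<union> {\<Delta>..<n}. b v) = path_ecc_sum D"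
    unfolding path_ecc_sum_def b_def
  proof (rule sum.reindex_bij_betw)
    show "bij_betw f ({0, 1} \<union> {\<Delta>..<n}) {..D}"
      by (rule bij_betw_byWitness[of _ "\<lambda>j. if j = 1 then 0 else if j = 0 then 1 else j + \<Delta> - 2"])
        (use assms in \<open>auto simp: f_def\<close>)
  qed
  ultimately have "real (path_ecc_sum D + (n - Suc D) * D) = (\<Sum>v<n. real (b v))"
    by (simp flip: of_nat_sum)
  also have "\<dots> \<le> (\<Sum>v<n. eccentricity (broom n \<Delta>) v)"
    unfolding b_def by (intro sum_mono ge) auto
  finally show ?thesis .
qed

section \<open>Comparison of a tree with the broom\<close>

context tree_graph
begin

lemma verts_nonempty: "verts G \<noteq> {}"
  using strongly_connected by (auto simp: strongly_connected_def)

lemma diameter_geodesic_exists: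
  obtains p d where "geodesic p d" "\<And>u v. u \<in> verts G \<Longrightarrow> v \<in> verts G \<Longrightarrow> hop_dist u v \<le> d"
proof -
  let ?A = "(\<lambda>(u, v). hop_dist u v) ` (verts G \<times> verts G)"
  have fin: "finite ?A" and ne: "?A \<noteq> {}"
    using verts_nonempty by auto
  obtain u v where uv: "u \<in> verts G" "v \<in> verts G" "hop_dist u v = Max ?A"
    using Max_in[OF fin ne] by auto
  have "hop_dist x y \<le> hop_dist u v" if "x \<in> verts G" "y \<in> verts G" for x y
    unfolding uv(3) using that by (intro Max_ge[OF fin]) auto
  moreover obtain p where "geodesic p (hop_dist u v)"
    using geodesic_exists[OF uv(1,2)] .
  ultimately show ?thesis
    using that by blast
qed

lemma max_degree_vertex_exists:
  obtains w where "w \<in> verts G" "card {v. w \<rightarrow> v} = max_degree G"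
proof -
  have "max_degree G \<in> out_degree G ` verts G"
    unfolding max_degree_def using verts_nonempty by (intro Max_in) auto
  then show ?thesis
    using that by (auto simp: card_neighbours)
qed

lemma card_neighbours_le_max_degree:
  assumes "v \<in> verts G"
  shows "card {u. v \<rightarrow> u} \<le> max_degree G"
  unfolding max_degree_def card_neighbours using assms by (intro Max_ge) auto

lemma card_geodesic: "geodesic p d \<Longrightarrow> card (p ` {..d}) = Suc d"
  using geodesic_inj by (simp add: card_image)

lemma geodesic_subset_verts: "geodesic p d \<Longrightarrow> p ` {..d} \<subseteq> verts G"
  using geodesic_in_verts by auto

lemma card_off_geodesic:
  assumes "geodesic p d"
  shows "card (verts G - p ` {..d}) = card (verts G) - Suc d"
  using card_Diff_subset[OF _ geodesic_subset_verts[OF assms]] card_geodesic[OF assms] by simp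

lemma Suc_length_geodesic_le:
  assumes "geodesic p d"
  shows "Suc d \<le> card (verts G)"
  using card_mono[OF finite_verts geodesic_subset_verts[OF assms]] card_geodesic[OF assms] by simp

text \<open>The bound \<open>c\<close> for the vertices off the geodesic is \<open>d\<close> in
  general and \<open>d - 1\<close> in the extremal case.\<close>

lemma sum_eccentricity_le:
  assumes p: "geodesic p d"
    and diam: "\<And>u v. u \<in> verts G \<Longrightarrow> v \<in> verts G \<Longrightarrow> hop_dist u v \<le> d"
    and off: "\<And>u v. u \<in> verts G \<Longrightarrow> v \<in> verts G - p ` {..d} \<Longrightarrow> hop_dist u v \<le> c"
  shows "(\<Sum>v\<in>verts G. eccentricity G v) \<le> real (path_ecc_sum d + (card (verts G) - Suc d) * c)"
proof -
  have "(\<Sum>v\<in>verts G. eccentricity G v) =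
      (\<Sum>v\<in>verts G - p ` {..d}. eccentricity G v) + (\<Sum>v\<in>p ` {..d}. eccentricity G v)"
    using sum.subset_diff[OF geodesic_subset_verts[OF p]] by simp
  also have "(\<Sum>v\<in>p ` {..d}. eccentricity G v) = (\<Sum>i\<le>d. eccentricity G (p i))"
    by (rule sum.reindex_cong[OF geodesic_inj[OF p]]) auto
  also have "\<dots> \<le> (\<Sum>i\<le>d. real (max i (d - i)))"
    using geodesic_in_verts[OF p] diam
    by (intro sum_mono eccentricity_le hop_dist_geodesic_le[OF p]) auto
  also have "\<dots> = real (path_ecc_sum d)"
    by (simp add: path_ecc_sum_def)
  also have "(\<Sum>v\<in>verts G - p ` {..d}. eccentricity G v) \<le>
      real (card (verts G - p ` {..d})) * real c"
    using off by (intro sum_bounded_above eccentricity_le) auto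
  finally show ?thesis
    by (simp add: card_off_geodesic[OF p])
qed

text \<open>Here \<open>p 1\<close> becomes the centre, \<open>p 0\<close> leaf 1,
  \<open>p 2\<close> leaf \<open>\<Delta>\<close>, and the vertices off the path become the other
  leaves in any order. These have no neighbour on the path except \<open>p 1\<close>, and are
  pairwise non-adjacent since all have distance 1 from \<open>p 1\<close>.\<close>

lemma broom_iso_of_geodesic:
  assumes p: "geodesic p d" and d: "2 \<le> d"
    and off: "\<And>v. v \<in> verts G \<Longrightarrow> v \<notin> p ` {..d} \<Longrightarrow> p 1 \<rightarrow> v"
  shows "digraph_iso G (broom (card (verts G)) (Suc (card (verts G)) - d))"
proof -
  define n \<Delta> where "n = card (verts G)" and "\<Delta> = Suc n - d"
  have n: "Suc d \<le> n" and \<Delta>: "2 \<le> \<Delta>" "\<Delta> < n" and d_eq: "d = Suc n - \<Delta>"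
    using Suc_length_geodesic_le[OF p] d by (auto simp: n_def \<Delta>_def)
  interpret B: connected_graph "broom n \<Delta>"
    using connected_graph_broom \<Delta> by simp
  have "card {2..<\<Delta>} = card (verts G - p ` {..d})"
    using card_off_geodesic[OF p] n d by (simp add: n_def \<Delta>_def)
  then obtain q where q: "bij_betw q {2..<\<Delta>} (verts G - p ` {..d})"
    by (metis finite_Diff finite_atLeastLessThan finite_same_card_bij finite_verts)
  \<comment> \<open>The index on \<open>p\<close> that corresponds to the broom vertex
    \<open>i\<close>; it matters only for \<open>i\<close> outside
    \<open>{2..<\<Delta>}\<close>.\<close>
  define a where "a i = (if i = 0 then 1 else if i = 1 then 0 else i + 2 - \<Delta>)" for i
  define f where "f i = (if i \<in> {2..<\<Delta>} then q i else p (a i))" for i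
  have a_le: "a i \<le> d" if "i < n" "i \<notin> {2..<\<Delta>}" for i
    using that d d_eq \<Delta> by (auto simp: a_def)
  have q_off: "q i \<in> verts G" "q i \<notin> p ` {..d}" if "i \<in> {2..<\<Delta>}" for i
    using bij_betwE[OF q] that by auto
  have qp: "q i \<rightarrow> p k \<longleftrightarrow> k = 1" if "i \<in> {2..<\<Delta>}" "k \<le> d" for i k
  proof
    have q1: "q i \<rightarrow> p 1"
      using adj_sym off q_off[OF that(1)] by blast
    then show "k = 1" if "q i \<rightarrow> p k"
      using off_geodesic_neighbour_unique[OF p q_off(2)] \<open>i \<in> _\<close> \<open>k \<le> d\<close> that d by force
    show "q i \<rightarrow> p k" if "k = 1"
      using q1 that by simp
  qed
  have pq: "p k \<rightarrow> q i \<longleftrightarrow> k = 1" if "i \<in> {2..<\<Delta>}" "k \<le> d" for i k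
    using qp[OF that] adj_sym by blast
  have qq: "\<not> q i \<rightarrow> q j" if "i \<in> {2..<\<Delta>}" "j \<in> {2..<\<Delta>}" for i j
  proof
    assume "q i \<rightarrow> q j"
    moreover have "p 1 \<in> verts G"
      using geodesic_in_verts[OF p] d by simp
    ultimately show False
      using hop_dist_adj_cases[of "q i" "q j" "p 1"] hop_dist_adj[OF off[OF q_off[OF that(1)]]]
        hop_dist_adj[OF off[OF q_off[OF that(2)]]] by simp
  qed
  have "inj_on f {..<n}"
  proof (rule inj_onI)
    fix i j assume ij: "i \<in> {..<n}" "j \<in> {..<n}" "f i = f j"
    consider "i \<in> {2..<\<Delta>}" "j \<in> {2..<\<Delta>}" | "i \<in> {2..<\<Delta>}" "j \<notin> {2..<\<Delta>}"
      | "i \<notin> {2..<\<Delta>}" "j \<in> {2..<\<Delta>}" | "i \<notin> {2..<\<Delta>}" "j \<notin> {2..<\<Delta>}"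
      by blast
    then show "i = j"
    proof cases
      case 1
      then show ?thesis
        using ij inj_onD[OF bij_betw_imp_inj_on[OF q]] unfolding f_def by simp
    next
      case 2
      then show ?thesis
        using ij q_off(2)[of i] a_le[of j] unfolding f_def by auto
    next
      case 3
      then show ?thesis
        using ij q_off(2)[of j] a_le[of i] unfolding f_def by (metis atMost_iff imageI lessThan_iff)
    next
      case 4
      then have "a i = a j"
        using ij a_le[of i] a_le[of j] inj_onD[OF geodesic_inj[OF p], of "a i" "a j"]
        unfolding f_def by auto
      then show ?thesis
        using 4 \<Delta> by (auto simp: a_def split: if_splits)
    qed
  qed
  moreover have "f ` {..<n} \<subseteq> verts G"
    using q_off(1) geodesic_in_verts[OF p] a_le by (auto simp: f_def)
  ultimately have "bij_betw f {..<n} (verts G)"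
    using card_subset_eq[OF finite_verts, of "f ` {..<n}"] by (simp add: bij_betw_def card_image n_def)
  moreover have "i \<rightarrow>\<^bsub>broom n \<Delta>\<^esub> j \<longleftrightarrow> f i \<rightarrow> f j" if "i < n" "j < n" for i j
  proof -
    consider "i \<in> {2..<\<Delta>}" "j \<in> {2..<\<Delta>}" | "i \<in> {2..<\<Delta>}" "j \<notin> {2..<\<Delta>}"
      | "i \<notin> {2..<\<Delta>}" "j \<in> {2..<\<Delta>}" | "i \<notin> {2..<\<Delta>}" "j \<notin> {2..<\<Delta>}"
      by blast
    then show ?thesis
    proof cases
      case 1
      then have "\<not> f i \<rightarrow> f j"
        using qq by (simp add: f_def)
      then show ?thesis
        using 1 by (auto simp: arcs_ends_broom broom_edges_def)
    next
      case 2
      then have "f i \<rightarrow> f j \<longleftrightarrow> j = 0"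
        using qp[of i "a j"] a_le[of j] that \<Delta> by (auto simp: f_def a_def)
      then show ?thesis
        using 2 by (auto simp: arcs_ends_broom broom_edges_def)
    next
      case 3
      then have "f i \<rightarrow> f j \<longleftrightarrow> i = 0"
        using pq[of j "a i"] a_le[of i] that \<Delta> by (auto simp: f_def a_def)
      then show ?thesis
        using 3 by (auto simp: arcs_ends_broom broom_edges_def)
    next
      case 4
      have "f i \<rightarrow> f j \<longleftrightarrow> a j = Suc (a i) \<or> a i = Suc (a j)"
        using geodesic_adj_iff[OF p a_le a_le] 4 that by (simp only: f_def if_False)
      also have "\<dots> \<longleftrightarrow> i \<rightarrow>\<^bsub>broom n \<Delta>\<^esub> j"
        using 4 that \<Delta> by (auto simp: arcs_ends_broom broom_edges_def a_def split: if_splits)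
      finally show ?thesis ..
    qed
  qed
  ultimately have "digraph_iso G (broom n \<Delta>)"
    using B.nomulti_digraph nomulti_digraph by (intro digraph_isoI) (auto simp: verts_broom)
  then show ?thesis
    by (simp add: n_def \<Delta>_def)
qed

text \<open>No walk from \<open>w\<close> leaves \<open>{w, x}\<close>, so the tree is a single
  edge. This case is separate because the diameter \<open>n - \<Delta> + 1\<close> of the broom
  presupposes \<open>2 \<le> \<Delta>\<close>.\<close>

lemma broom_iso_of_max_degree_1:
  assumes "max_degree G = 1"
  shows "digraph_iso G (broom (card (verts G)) 1)"
proof -
  obtain w where "w \<in> verts G" "card {v. w \<rightarrow> v} = 1"
    using max_degree_vertex_exists assms by metis
  then obtain x where wx: "w \<rightarrow> x"
    by (metis card_1_singletonE mem_Collect_eq singletonI)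
  have uniq: "y = z" if "v \<rightarrow> y" "v \<rightarrow> z" for v y z
  proof -
    have "card {y. v \<rightarrow> y} \<le> 1"
      using card_neighbours_le_max_degree[of v] adj_in_verts[OF that(1)] assms by simp
    then show ?thesis
      using that card_le_Suc0_iff_eq[OF finite_neighbours, of v] by simp
  qed
  have "v = w \<or> v = x" if "w \<rightarrow>\<^sup>* v" for v
    using that
  proof (induction rule: reachable_induct)
    case (step y z)
    then show ?case using uniq wx adj_sym by blast
  qed simp
  then have V: "verts G = {w, x}"
    using strongly_connected adj_in_verts[OF wx] by (auto elim!: strongly_connectedE)
  have "w \<noteq> x"
    using adj_neq[OF wx] .
  then have n: "card (verts G) = 2"
    using V by simp
  interpret B: connected_graph "broom 2 1"
    using connected_graph_broom by simp
  let ?f = "\<lambda>i :: nat. if i = 0 then w else x"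
  have "bij_betw ?f {..<2} (verts G)"
    using \<open>w \<noteq> x\<close> V by (simp add: bij_betw_def numeral_2_eq_2 lessThan_Suc insert_commute)
  moreover have "i \<rightarrow>\<^bsub>broom 2 1\<^esub> j \<longleftrightarrow> ?f i \<rightarrow> ?f j" if "i < 2" "j < 2" for i j
    using that wx adj_sym[OF wx] adj_not_same
    by (auto simp: arcs_ends_broom broom_edges_def less_2_cases_iff)
  ultimately have "digraph_iso G (broom 2 1)"
    using B.nomulti_digraph nomulti_digraph by (intro digraph_isoI) (auto simp: verts_broom)
  then show ?thesis
    by (simp add: n)
qed

lemma sum_eccentricity_less:
  assumes "2 \<le> max_degree G"
    and n: "n = card (verts G)" and \<Delta>: "\<Delta> = max_degree G" and D: "D = Suc n - \<Delta>"
    and not_iso: "\<not> digraph_iso G (broom n \<Delta>)"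
  shows "\<Delta> < n"
    and "(\<Sum>v\<in>verts G. eccentricity G v) < real (path_ecc_sum D + (n - Suc D) * D)"
proof -
  obtain w where w: "w \<in> verts G" "card {v. w \<rightarrow> v} = \<Delta>"
    using max_degree_vertex_exists \<Delta> by metis
  let ?N = "{v. w \<rightarrow> v}"
  have N: "?N \<subseteq> verts G - {w}"
    using adj_in_verts adj_neq by blast
  then have "card ?N \<le> card (verts G - {w})"
    by (intro card_mono) auto
  then show "\<Delta> < n"
    using w n card_gt_0_iff[of "verts G"] verts_nonempty by (simp add: card_Diff_singleton)
  obtain p d where p: "geodesic p d"
    and diam: "\<And>u v. u \<in> verts G \<Longrightarrow> v \<in> verts G \<Longrightarrow> hop_dist u v \<le> d"
    using diameter_geodesic_exists by blast
  define P where "P = p ` {..d}"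
  have off: "card (verts G - P) = n - Suc d" and dn: "Suc d \<le> n"
    using card_off_geodesic[OF p] Suc_length_geodesic_le[OF p] by (simp_all add: P_def n)
  have split: "\<Delta> = card (?N \<inter> P) + card (?N - P)"
    using w(2) card_Int_Diff[OF finite_neighbours, of w P] by simp
  have "(\<Sum>v\<in>verts G. eccentricity G v) \<le> real (path_ecc_sum d + (n - Suc d) * d)"
    using sum_eccentricity_le[OF p diam, of d] diam n by simp
  moreover have D_le: "D < n"
    using assms \<open>\<Delta> < n\<close> by simp
  ultimately have less: "(\<Sum>v\<in>verts G. eccentricity G v) < real (path_ecc_sum D + (n - Suc D) * D)"
    if "d < D"
    using path_ecc_sum_less[OF that D_le] by linarith
  show "(\<Sum>v\<in>verts G. eccentricity G v) < real (path_ecc_sum D + (n - Suc D) * D)"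
  proof (cases "w \<in> P")
    \<comment> \<open>Off the path, \<open>w\<close> has at most one neighbour on it and at most
      \<open>n - d - 2\<close> elsewhere, so \<open>d < D\<close>.\<close>
    case False
    have "card (?N \<inter> P) \<le> 1"
      using off_geodesic_neighbour_unique[OF p False[unfolded P_def]] finite_neighbours
      by (subst One_nat_def, subst card_le_Suc0_iff_eq) (auto simp: P_def)
    moreover have "card (?N - P) \<le> card (verts G - P - {w})"
      using N by (intro card_mono) auto
    moreover have "card (verts G - P - {w}) < n - Suc d"
      using card_Diff1_less[of "verts G - P" w] False w off by simp
    ultimately show ?thesis
      using split D by (intro less) simp
  next
    case True
    then obtain k where k: "k \<le> d" "w = p k"
      by (auto simp: P_def)
    \<comment> \<open>The indices of the neighbours of \<open>w\<close> on the path. There are at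
      most two, whence \<open>\<Delta> \<le> 2 + (n - Suc d)\<close>, that is,
      \<open>d \<le> D\<close>.\<close>
    define K where "K = {i. i \<le> d \<and> (i = Suc k \<or> k = Suc i)}"
    have NP: "?N \<inter> P = p ` K"
      unfolding P_def K_def using geodesic_adj_iff[OF p k(1)] k(2) by auto
    have K: "K \<subseteq> {Suc k, k - 1}"
      by (auto simp: K_def)
    have "card K \<le> 2"
      using card_mono[OF _ K] card_insert_le_m1[of 2 "{k - 1}" "Suc k"] by simp
    moreover have "card (?N \<inter> P) \<le> card K"
      unfolding NP using finite_subset[OF K] by (intro card_image_le) auto
    moreover have sub: "?N - P \<subseteq> verts G - P"
      using N by auto
    moreover have "card (?N - P) \<le> n - Suc d"
      using card_mono[OF _ sub] off by simp
    ultimately have "d \<le> D"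
      using split D dn \<open>\<Delta> < n\<close> by linarith
    show ?thesis
    proof (cases "d < D")
      case True
      then show ?thesis by (rule less)
    next
      case False
      then have dD: "d = D"
        using \<open>d \<le> D\<close> by simp
      have "n - Suc d = \<Delta> - 2"
        using dD D \<open>\<Delta> < n\<close> by simp
      \<comment> \<open>For \<open>d = D\<close> the count is tight: \<open>w\<close> has two
        neighbours on the path and is adjacent to every vertex off it.\<close>
      then have cK: "card K = 2" and "card (?N - P) = n - Suc d"
        using split \<open>card K \<le> 2\<close> \<open>card (?N \<inter> P) \<le> card K\<close> \<open>card (?N - P) \<le> n - Suc d\<close>
          assms(1) \<Delta> by linarith+
      then have "?N - P = verts G - P"
        using card_subset_eq[OF _ sub] off by simp
      then have offN: "p k \<rightarrow> v" if "v \<in> verts G" "v \<notin> P" for v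
        using that k(2) by blast
      have "0 < k" "k < d"
      proof -
        have "K = {Suc k, k - 1}"
          using card_subset_eq[OF _ K] cK card_insert_le_m1[of 2 "{k - 1}" "Suc k"]
            card_mono[OF _ K] by simp
        \<comment> \<open>Truncated subtraction makes \<open>k - 1\<close> equal to 0 for
          \<open>k = 0\<close>, but then it is not in \<open>K\<close>; so membership excludes both
          ends of the path.\<close>
        then have "Suc k \<in> K" "k - 1 \<in> K"
          by auto
        then show "0 < k" "k < d"
          unfolding K_def by auto
      qed
      have \<Delta>_eq: "\<Delta> = Suc n - d"
        using dD D \<open>\<Delta> < n\<close> by simp
      have no_iso: False if "geodesic p' d" "p' ` {..d} = P"
        "\<And>v. v \<in> verts G \<Longrightarrow> v \<notin> P \<Longrightarrow> p' 1 \<rightarrow> v" for p'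
        using broom_iso_of_geodesic[OF that(1)] that(2,3) not_iso \<open>0 < k\<close> \<open>k < d\<close>
        by (simp add: n[symmetric] \<Delta>_eq)
      \<comment> \<open>Otherwise the tree would be a path, which is the broom with
        \<open>\<Delta> = 2\<close>.\<close>
      have off_ne: "verts G - P \<noteq> {}"
        using no_iso[OF p] by (auto simp: P_def)
      have "k \<noteq> 1"
        using no_iso[OF p] offN by (auto simp: P_def)
      \<comment> \<open>The reversed geodesic moves \<open>p (d - 1)\<close> to index 1.\<close>
      moreover have "k \<noteq> d - 1"
      proof
        assume "k = d - 1"
        moreover have "(\<lambda>i. p (d - i)) ` {..d} = P"
        proof -
          have "(\<lambda>i. d - i) ` {..d} = {..d}"
            by (rule bij_betw_imp_surj_on[OF bij_betw_byWitness[of _ "\<lambda>i. d - i"]]) auto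
          then show ?thesis
            unfolding P_def by (metis image_image)
        qed
        ultimately show False
          using no_iso[OF geodesic_rev[OF p]] offN by simp
      qed
      \<comment> \<open>Now \<open>2 \<le> k\<close> and \<open>k \<le> d - 2\<close>, so a vertex
        attached to \<open>p k\<close> stays within distance \<open>d - 1\<close> of all
        others.\<close>
      ultimately have k: "Suc (max k (d - k)) \<le> d - 1"
        using \<open>0 < k\<close> \<open>k < d\<close> by auto
      have "hop_dist u v \<le> d - 1" if "u \<in> verts G" "v \<in> verts G - p ` {..d}" for u v
      proof -
        have "hop_dist u v \<le> hop_dist u (p k) + hop_dist (p k) v"
          using that geodesic_in_verts[OF p] \<open>k < d\<close> by (intro hop_dist_triangle) auto
        moreover have "hop_dist (p k) v = 1"
          using offN that by (intro hop_dist_adj) (auto simp: P_def)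
        moreover have "hop_dist u (p k) \<le> max k (d - k)"
          using that geodesic_in_verts[OF p] \<open>k < d\<close> diam by (intro hop_dist_geodesic_le[OF p]) auto
        ultimately show ?thesis
          using k by linarith
      qed
      then have "(\<Sum>v\<in>verts G. eccentricity G v) \<le> real (path_ecc_sum d + (n - Suc d) * (d - 1))"
        using sum_eccentricity_le[OF p diam, of "d - 1"] n by simp
      \<comment> \<open>Strict because some vertex lies off the path.\<close>
      moreover have "(n - Suc d) * (d - 1) < (n - Suc d) * d"
        using off off_ne \<open>k < d\<close> card_gt_0_iff[of "verts G - P"] by simp
      ultimately show ?thesis
        unfolding dD[symmetric] by linarith
    qed
  qed
qed

end

theorem mainTheorem2:
  fixes n \<Delta> :: nat and T :: "('a, 'b) pre_digraph"
  assumes "0 < n" and "0 < \<Delta>"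
    and "undirected_tree T"
    and "card (verts T) = n"
    and "max_degree T = \<Delta>"
    and "\<not> digraph_iso T (broom n \<Delta>)"
  shows "ecc (broom n \<Delta>) > ecc T"
proof -
  interpret graph T
    using assms(3) by (simp add: undirected_tree_def)
  interpret tree_graph T
  proof unfold_locales
    show "strongly_connected T"
      using assms(3) sym_arcs
      by (auto simp: undirected_tree_def intro: symmetric_connected_imp_strongly_connected)
    show "length p < 3" if "cycle p" for p
      using assms(3) that by (force simp: undirected_tree_def)
  qed
  have "\<Delta> \<noteq> 1"
    using broom_iso_of_max_degree_1 assms by auto
  then have \<Delta>: "2 \<le> \<Delta>"
    using assms(2) by simp
  define D where "D = Suc n - \<Delta>"
  \<comment> \<open>Both graphs have \<open>n\<close> vertices, so it suffices to compare the
    eccentricity sums; the bound for diameter \<open>D\<close> separates them.\<close>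
  note tree = sum_eccentricity_less[OF \<Delta>[folded assms(5)] assms(4,5)[symmetric] D_def assms(6)]
  note tree(2)
  also have "real (path_ecc_sum D + (n - Suc D) * D) \<le> (\<Sum>v<n. eccentricity (broom n \<Delta>) v)"
    using sum_eccentricity_broom_ge[OF \<Delta> tree(1) D_def] .
  finally show ?thesis
    unfolding ecc_def verts_broom assms(4) card_lessThan
    using assms(1) by (intro mult_strict_left_mono) simp_all
qed

end
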